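(* Let $(G,0)$ be a rooted graph, let $A_\bullet=(A_n)_{n\in\mathbb N}$ be a $(G,0)$-tower of algebras, with label set $\Lambda=\bigcup_n\Lambda_n$ (the vertex set of $G$), and for $n\in\mathbb N$, $\lambda\in\Lambda$ let $Y_A(n;\lambda)$ be the set of paths in the $\Delta$-Bratteli diagram of $A_\bullet$ from $\Delta_0(0)$ to $\Delta_n(\lambda)$ (the empty set if $\lambda\notin\Lambda_n$). Then the array $Y_A$ is equivalent to the path array $Y_{G,0}$; in other words, $Y_A$ is a Pascal $(G,0)$-array.
   Context: Let $k$ be a field; $\mathbb N=\{0,1,2,\dots\}$. For a $k$-algebra $A$ and a set $\Delta$ of $A$-modules, a $\Delta$-filtration of an $A$-module $M$ is a filtration all of whose sections are in $\Delta$ (up to isomorphism); $M$ is $\Delta$-good if it has a $\Delta$-filtration and the multiplicity of each $L\in\Delta$ in a $\Delta$-filtration of $M$ does not depend on the filtration; this multiplicity is denoted $[M:L]$. A tower $A_\bullet$ of $k$-algebras $A_0,A_1,A_2,\dots$ is a $(G,0)$-tower of algebras if: (N1) For all $n\in\mathbb N$ there is an algebra embedding $A_n\hookrightarrow A_{n+1}$. (Hence for $n\ge 1$ a restriction functor $\mathrm{res}_n: A_n\text{-mod}\to A_{n-1}\text{-mod}$.) (N2) For all $n$ there is a set $\Lambda_n$ and an $A_n$-module $\Delta_n(\lambda)$ for each $\lambda\in\Lambda_n$, with $\Delta_n(\lambda)\not\cong\Delta_n(\mu)$ if $\lambda\ne\mu$. (N3) There is a fixed $N\in\mathbb N$ such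 that $\Lambda_{n-N}\subseteq\Lambda_n$ for all $n\ge N$; and whenever $\Lambda_n\cap\Lambda_m\neq\emptyset$, $n\equiv m \bmod N$. (N4) For all $n\ge1$ and $\lambda\in\Lambda_n$, $\mathrm{res}_n(\Delta_n(\lambda))$ is a $\Delta$-good $A_{n-1}$-module, with respect to $\Delta=\{\Delta_{n-1}(\mu):\mu\in\Lambda_{n-1}\}$. (N5) $\Lambda_0=\{0\}$ has one element, and $\Delta_0(0)$ is a one-dimensional simple $A_0$-module. (N6) For all $n\ge N$ there is an exact functor $F_n:A_n\text{-mod}\to A_{n-N}\text{-mod}$. (N7) For all $n\ge N$ and $\lambda\in\Lambda_n$, $F_n(\Delta_n(\lambda))\cong\Delta_{n-N}(\lambda)$ if $\lambda\in\Lambda_{n-N}$, and $F_n(\Delta_n(\lambda))=0$ otherwise. (N8) For all $n\ge N+1$ and $\lambda\in\Lambda_n$ with $F_n(\Delta_n(\lambda))\ne0$: $F_{n-1}(\mathrm{res}_n\Delta_n(\lambda))\cong \mathrm{res}_{n-N}(F_n\Delta_n(\lambda))$. (N9) $G$ is a (directed) graph with vertex set $\Lambda=\bigcup_{n}\Lambda_n$ such that for every arrow $\alpha$ from $\lambda$ to $\mu$ in $G$ and every $n$ with $\lambda\in\Lambda_n$ there is a corresponding arrow $\alpha_n$ in the $\Delta$-Bratteli diagram from $\Delta_n(\lambda)$ to $\Delta_{n+1}(\mu)$; these arrows $\alpha_n$ are all distinct and exhaust the arrows of the $\Delta$-Bratteli diagram. Here the $\Delta$-Bratteli diagram of $A_\bullet$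 has as vertices the modules $\Delta_n(\lambda)$ ($n\in\mathbb N$, $\lambda\in\Lambda_n$), with exactly $m$ arrows from $\Delta_n(\lambda)$ to $\Delta_{n+1}(\mu)$, where $m=[\mathrm{res}_{n+1}\Delta_{n+1}(\mu):\Delta_n(\lambda)]$. For a rooted graph $(G,v_0)$ with vertices $V$, directed edges $E$, and initial/final maps $i,f:E\to V$, $Y_{G,v_0}(n;v)$ is the set of directed paths of length $n$ from $v_0$ to $v$. A Pascal $(G,v_0)$-array (= array equivalent to $Y_{G,v_0}$) is a family of sets $Y(n;v)$, $n\in\mathbb N$, $v\in V$, with $Y(0;v_0)$ a singleton and $Y(0;v)=\emptyset$ for $v\neq v_0$, for which there are injective edge maps $\phi'_e:Y(n-1;i(e))\hookrightarrow Y(n;f(e))$ ($e\in E$, $n\ge1$) such that $Y(n;v)=\bigsqcup_{e:\,f(e)=v}\phi'_e(Y(n-1;i(e)))$ (disjoint union). *)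

theory Defs
  imports
    "HOL-Algebra.QuotRing"
    "HOL-Algebra.Module"
    "HOL-Library.Disjoint_Sets"
    "HOL-Number_Theory.Cong"
    "Graph_Theory.Arc_Walk"
begin

section \<open>Algebras and left modules\<close>

text \<open>
  The locales \<^locale>\<open>algebra\<close> and \<^locale>\<open>Module.module\<close> of HOL-Algebra are restricted to
  commutative rings, so the versions for not necessarily commutative rings are introduced here.
  They use the record type of \<^locale>\<open>Module.module\<close>. Its fields for multiplication and one carry
  the ring structure when the record is an algebra, and are ignored when it is a module.
\<close>

locale assoc_algebra = K?: field K + A?: ring A
  for K :: "('k, 'c) ring_scheme" (structure) and A :: "('k, 'a) module" (structure) +
  assumes module_over_field: "Module.module K A"
    and smult_mult_left:
      "\<lbrakk>c \<in> carrier K; x \<in> carrier A; y \<in> carrier A\<rbrakk>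
        \<Longrightarrow> c \<odot>\<^bsub>A\<^esub> (x \<otimes>\<^bsub>A\<^esub> y) = (c \<odot>\<^bsub>A\<^esub> x) \<otimes>\<^bsub>A\<^esub> y"
    and smult_mult_right:
      "\<lbrakk>c \<in> carrier K; x \<in> carrier A; y \<in> carrier A\<rbrakk>
        \<Longrightarrow> c \<odot>\<^bsub>A\<^esub> (x \<otimes>\<^bsub>A\<^esub> y) = x \<otimes>\<^bsub>A\<^esub> (c \<odot>\<^bsub>A\<^esub> y)"

definition algebra_embedding ::
  "('k, 'c) ring_scheme \<Rightarrow> ('k, 'a) module \<Rightarrow> ('k, 'b) module \<Rightarrow> ('a \<Rightarrow> 'b) \<Rightarrow> bool" where
  "algebra_embedding K A B h \<longleftrightarrow>
     h \<in> ring_hom A B \<and>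
     (\<forall>c\<in>carrier K. \<forall>x\<in>carrier A. h (c \<odot>\<^bsub>A\<^esub> x) = c \<odot>\<^bsub>B\<^esub> h x) \<and>
     inj_on h (carrier A)"

locale left_module = R?: ring R + M?: abelian_group M
  for R :: "('a, 'c) ring_scheme" (structure) and M :: "('a, 'm) module" (structure) +
  assumes smult_closed:
      "\<lbrakk>a \<in> carrier R; x \<in> carrier M\<rbrakk> \<Longrightarrow> a \<odot>\<^bsub>M\<^esub> x \<in> carrier M"
    and smult_l_distr:
      "\<lbrakk>a \<in> carrier R; b \<in> carrier R; x \<in> carrier M\<rbrakk>
        \<Longrightarrow> (a \<oplus>\<^bsub>R\<^esub> b) \<odot>\<^bsub>M\<^esub> x = a \<odot>\<^bsub>M\<^esub> x \<oplus>\<^bsub>M\<^esub> b \<odot>\<^bsub>M\<^esub> x"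
    and smult_r_distr:
      "\<lbrakk>a \<in> carrier R; x \<in> carrier M; y \<in> carrier M\<rbrakk>
        \<Longrightarrow> a \<odot>\<^bsub>M\<^esub> (x \<oplus>\<^bsub>M\<^esub> y) = a \<odot>\<^bsub>M\<^esub> x \<oplus>\<^bsub>M\<^esub> a \<odot>\<^bsub>M\<^esub> y"
    and smult_assoc:
      "\<lbrakk>a \<in> carrier R; b \<in> carrier R; x \<in> carrier M\<rbrakk>
        \<Longrightarrow> (a \<otimes>\<^bsub>R\<^esub> b) \<odot>\<^bsub>M\<^esub> x = a \<odot>\<^bsub>M\<^esub> (b \<odot>\<^bsub>M\<^esub> x)"
    and smult_one: "x \<in> carrier M \<Longrightarrow> \<one>\<^bsub>R\<^esub> \<odot>\<^bsub>M\<^esub> x = x"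

text \<open>Homomorphisms are extensional, so that equal morphisms are equal functions.\<close>

definition module_hom ::
  "('a, 'c) ring_scheme \<Rightarrow> ('a, 'm) module \<Rightarrow> ('a, 'n) module \<Rightarrow> ('m \<Rightarrow> 'n) set" where
  "module_hom R M M' =
     {f \<in> carrier M \<rightarrow>\<^sub>E carrier M'.
        (\<forall>x\<in>carrier M. \<forall>y\<in>carrier M. f (x \<oplus>\<^bsub>M\<^esub> y) = f x \<oplus>\<^bsub>M'\<^esub> f y) \<and>
        (\<forall>a\<in>carrier R. \<forall>x\<in>carrier M. f (a \<odot>\<^bsub>M\<^esub> x) = a \<odot>\<^bsub>M'\<^esub> f x)}"

definition module_iso ::
  "('a, 'c) ring_scheme \<Rightarrow> ('a, 'm) module \<Rightarrow> ('a, 'n) module \<Rightarrow> bool" where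
  "module_iso R M M' \<longleftrightarrow> (\<exists>f\<in>module_hom R M M'. bij_betw f (carrier M) (carrier M'))"

definition zero_module :: "('a, 'm) module \<Rightarrow> bool" where
  "zero_module M \<longleftrightarrow> carrier M = {\<zero>\<^bsub>M\<^esub>}"

definition simple_module :: "('a, 'c) ring_scheme \<Rightarrow> ('a, 'm) module \<Rightarrow> bool" where
  "simple_module R M \<longleftrightarrow>
     left_module R M \<and> \<not> zero_module M \<and>
     (\<forall>H. submodule H R M \<longrightarrow> H = {\<zero>\<^bsub>M\<^esub>} \<or> H = carrier M)"

definition restrict_scalars :: "('b \<Rightarrow> 'a) \<Rightarrow> ('a, 'm) module \<Rightarrow> ('b, 'm) module" where
  "restrict_scalars h M =
     \<lparr>carrier = carrier M, monoid.mult = monoid.mult M, one = one M, zero = zero M, add = add M,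
      smult = (\<lambda>b x. h b \<odot>\<^bsub>M\<^esub> x)\<rparr>"

definition quotient_module :: "('a, 'm) module \<Rightarrow> 'm set \<Rightarrow> ('a, 'm set) module" where
  "quotient_module M H =
     \<lparr>carrier = a_rcosets\<^bsub>M\<^esub> H, monoid.mult = undefined, one = undefined,
      zero = H, add = set_add M,
      smult = (\<lambda>a X. \<Union>x\<in>X. H +>\<^bsub>M\<^esub> (a \<odot>\<^bsub>M\<^esub> x))\<rparr>"

definition has_dimension :: "('k, 'c) ring_scheme \<Rightarrow> ('k, 'm) module \<Rightarrow> nat \<Rightarrow> bool" where
  "has_dimension K V d \<longleftrightarrow>
     (\<exists>B. B \<subseteq> carrier V \<and> finite B \<and> card B = d \<and>
       (\<forall>v\<in>carrier V. \<exists>!c. c \<in> B \<rightarrow>\<^sub>E carrier K \<and> v = (\<Oplus>\<^bsub>V\<^esub>b\<in>B. c b \<odot>\<^bsub>V\<^esub> b)))"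

text \<open>The vector space underlying a module over a \<open>K\<close>-algebra: \<open>K\<close> acts through
  \<open>c \<mapsto> c \<cdot> 1\<close>.\<close>

definition underlying_space :: "('k, 'a) module \<Rightarrow> ('a, 'm) module \<Rightarrow> ('k, 'm) module" where
  "underlying_space A M = restrict_scalars (\<lambda>c. c \<odot>\<^bsub>A\<^esub> \<one>\<^bsub>A\<^esub>) M"


section \<open>Exact functors\<close>

definition short_exact ::
  "('a, 'c) ring_scheme \<Rightarrow> ('a, 'm) module \<Rightarrow> ('m \<Rightarrow> 'm) \<Rightarrow> ('a, 'm) module \<Rightarrow>
   ('m \<Rightarrow> 'm) \<Rightarrow> ('a, 'm) module \<Rightarrow> bool" where
  "short_exact R L f M g P \<longleftrightarrow>
     left_module R L \<and> left_module R M \<and> left_module R P \<and>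
     f \<in> module_hom R L M \<and> g \<in> module_hom R M P \<and>
     inj_on f (carrier L) \<and> f ` carrier L = a_kernel M P g \<and> g ` carrier M = carrier P"

text \<open>
  The category of \<open>R\<close>-modules consists of all left \<open>R\<close>-modules whose elements belong to a
  type \<open>'m\<close>, which plays the role of a universe. A functor consists of a map \<open>Fo\<close> on objects
  and a map \<open>Fm\<close> on morphisms; \<open>Fm M M' f\<close> is the image of \<open>f : M \<rightarrow> M'\<close>. As usual for
  functors between abelian categories, exact functors are additive by convention.
\<close>

locale exact_functor =
  fixes R :: "('a, 'c) ring_scheme" and S :: "('b, 'd) ring_scheme"
    and Fo :: "('a, 'm) module \<Rightarrow> ('b, 'm) module"
    and Fm :: "('a, 'm) module \<Rightarrow> ('a, 'm) module \<Rightarrow> ('m \<Rightarrow> 'm) \<Rightarrow> 'm \<Rightarrow> 'm"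
  assumes obj: "left_module R M \<Longrightarrow> left_module S (Fo M)"
    and mor:
      "\<lbrakk>left_module R M; left_module R M'; f \<in> module_hom R M M'\<rbrakk>
        \<Longrightarrow> Fm M M' f \<in> module_hom S (Fo M) (Fo M')"
    and ident:
      "left_module R M \<Longrightarrow> Fm M M (\<lambda>x\<in>carrier M. x) = (\<lambda>x\<in>carrier (Fo M). x)"
    and comp:
      "\<lbrakk>left_module R M; left_module R M'; left_module R M'';
        f \<in> module_hom R M M'; g \<in> module_hom R M' M''\<rbrakk>
        \<Longrightarrow> Fm M M'' (compose (carrier M) g f) =
            compose (carrier (Fo M)) (Fm M' M'' g) (Fm M M' f)"
    and additive:
      "\<lbrakk>left_module R M; left_module R M'; f \<in> module_hom R M M'; g \<in> module_hom R M M'\<rbrakk>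
        \<Longrightarrow> Fm M M' (\<lambda>x\<in>carrier M. f x \<oplus>\<^bsub>M'\<^esub> g x) =
            (\<lambda>x\<in>carrier (Fo M). Fm M M' f x \<oplus>\<^bsub>Fo M'\<^esub> Fm M M' g x)"
    and exact:
      "short_exact R L f M g P
        \<Longrightarrow> short_exact S (Fo L) (Fm L M f) (Fo M) (Fm M P g) (Fo P)"


section \<open>Filtrations\<close>

text \<open>A filtration \<open>0 = H\<^sub>0 \<subseteq> H\<^sub>1 \<subseteq> \<dots> \<subseteq> H\<^sub>r = M\<close> is the list of its terms.\<close>

definition filtration_section :: "('a, 'm) module \<Rightarrow> 'm set list \<Rightarrow> nat \<Rightarrow> ('a, 'm set) module" where
  "filtration_section M Hs i = quotient_module (M\<lparr>carrier := Hs ! Suc i\<rparr>) (Hs ! i)"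

definition is_filtration ::
  "('a, 'c) ring_scheme \<Rightarrow> ('a, 'm) module set \<Rightarrow> ('a, 'm) module \<Rightarrow> 'm set list \<Rightarrow> bool" where
  "is_filtration R D M Hs \<longleftrightarrow>
     Hs \<noteq> [] \<and> hd Hs = {\<zero>\<^bsub>M\<^esub>} \<and> last Hs = carrier M \<and>
     (\<forall>H\<in>set Hs. submodule H R M) \<and>
     (\<forall>i. Suc i < length Hs \<longrightarrow>
        Hs ! i \<subseteq> Hs ! Suc i \<and> (\<exists>L\<in>D. module_iso R (filtration_section M Hs i) L))"

definition filtration_multiplicity ::
  "('a, 'c) ring_scheme \<Rightarrow> ('a, 'm) module \<Rightarrow> 'm set list \<Rightarrow> ('a, 'm) module \<Rightarrow> nat" where
  "filtration_multiplicity R M Hs L =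
     card {i. Suc i < length Hs \<and> module_iso R (filtration_section M Hs i) L}"

definition good ::
  "('a, 'c) ring_scheme \<Rightarrow> ('a, 'm) module set \<Rightarrow> ('a, 'm) module \<Rightarrow> bool" where
  "good R D M \<longleftrightarrow>
     left_module R M \<and> (\<exists>Hs. is_filtration R D M Hs) \<and>
     (\<forall>L\<in>D. \<forall>Hs Hs'. is_filtration R D M Hs \<longrightarrow> is_filtration R D M Hs' \<longrightarrow>
        filtration_multiplicity R M Hs L = filtration_multiplicity R M Hs' L)"

definition multiplicity_in ::
  "('a, 'c) ring_scheme \<Rightarrow> ('a, 'm) module set \<Rightarrow> ('a, 'm) module \<Rightarrow> ('a, 'm) module \<Rightarrow> nat" where
  "multiplicity_in R D M L =
     (THE m. \<forall>Hs. is_filtration R D M Hs \<longrightarrow> filtration_multiplicity R M Hs L = m)"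


section \<open>Rooted graphs and Pascal arrays\<close>

locale rooted_digraph = wf_digraph G for G :: "('v, 'e) pre_digraph" (structure) +
  fixes v0 :: 'v
  assumes root_in_verts: "v0 \<in> verts G"

definition path_array :: "('v, 'e) pre_digraph \<Rightarrow> 'v \<Rightarrow> nat \<Rightarrow> 'v \<Rightarrow> 'e list set" where
  "path_array G v0 n v = {p. pre_digraph.awalk G v0 p v \<and> length p = n}"

text \<open>\<open>\<phi> n e\<close> is the edge map of \<open>e\<close> from level \<open>n\<close> to level \<open>n + 1\<close>.\<close>

definition pascal_edge_maps ::
  "('v, 'e) pre_digraph \<Rightarrow> 'v \<Rightarrow> (nat \<Rightarrow> 'v \<Rightarrow> 'x set) \<Rightarrow> (nat \<Rightarrow> 'e \<Rightarrow> 'x \<Rightarrow> 'x) \<Rightarrow> bool" where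
  "pascal_edge_maps G v0 Y \<phi> \<longleftrightarrow>
     (\<exists>x. Y 0 v0 = {x}) \<and> (\<forall>v\<in>verts G. v \<noteq> v0 \<longrightarrow> Y 0 v = {}) \<and>
     (\<forall>n. \<forall>e\<in>arcs G.
        inj_on (\<phi> n e) (Y n (tail G e)) \<and>
        \<phi> n e ` Y n (tail G e) \<subseteq> Y (Suc n) (head G e)) \<and>
     (\<forall>n. \<forall>v\<in>verts G.
        Y (Suc n) v = (\<Union>e\<in>{e \<in> arcs G. head G e = v}. \<phi> n e ` Y n (tail G e)) \<and>
        disjoint_family_on (\<lambda>e. \<phi> n e ` Y n (tail G e)) {e \<in> arcs G. head G e = v})"

definition pascal_array ::
  "('v, 'e) pre_digraph \<Rightarrow> 'v \<Rightarrow> (nat \<Rightarrow> 'v \<Rightarrow> 'x set) \<Rightarrow> bool" where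
  "pascal_array G v0 Y \<longleftrightarrow> (\<exists>\<phi>. pascal_edge_maps G v0 Y \<phi>)"

text \<open>The edge map of \<open>e\<close> for the path array itself is \<open>p \<mapsto> p @ [e]\<close>. An equivalence is a family
  of bijections compatible with the edge maps on both sides.\<close>

definition equivalent_to_path_array ::
  "('v, 'e) pre_digraph \<Rightarrow> 'v \<Rightarrow> (nat \<Rightarrow> 'v \<Rightarrow> 'x set) \<Rightarrow> bool" where
  "equivalent_to_path_array G v0 Y \<longleftrightarrow>
     (\<exists>\<phi> \<beta>. pascal_edge_maps G v0 Y \<phi> \<and>
        (\<forall>n. \<forall>v\<in>verts G. bij_betw (\<beta> n v) (path_array G v0 n v) (Y n v)) \<and>
        (\<forall>n. \<forall>e\<in>arcs G. \<forall>p\<in>path_array G v0 n (tail G e).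
           \<beta> (Suc n) (head G e) (p @ [e]) = \<phi> n e (\<beta> n (tail G e) p)))"


section \<open>Towers of algebras\<close>

text \<open>Restriction from level \<open>n \<ge> 1\<close> to level \<open>n - 1\<close>, where \<open>\<iota> n\<close> embeds level \<open>n\<close> into
  level \<open>n + 1\<close>.\<close>

definition res :: "(nat \<Rightarrow> 'a \<Rightarrow> 'a) \<Rightarrow> nat \<Rightarrow> ('a, 'm) module \<Rightarrow> ('a, 'm) module" where
  "res \<iota> n M = restrict_scalars (\<iota> (n - 1)) M"

text \<open>
  The vertex \<open>\<Delta>\<^sub>n(\<lambda>)\<close> of the Bratteli diagram is represented by \<open>(n, \<lambda>)\<close>, because modules on
  different levels may coincide as records; \<open>(n, \<lambda>, \<mu>, j)\<close> is the \<open>j\<close>-th arrow from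
  \<open>\<Delta>\<^sub>n(\<lambda>)\<close> to \<open>\<Delta>\<^sub>n\<^sub>+\<^sub>1(\<mu>)\<close>.
\<close>

definition bratteli_diagram ::
  "(nat \<Rightarrow> ('k, 'a) module) \<Rightarrow> (nat \<Rightarrow> 'a \<Rightarrow> 'a) \<Rightarrow> (nat \<Rightarrow> 'l set) \<Rightarrow>
   (nat \<Rightarrow> 'l \<Rightarrow> ('a, 'm) module) \<Rightarrow> (nat \<times> 'l, nat \<times> 'l \<times> 'l \<times> nat) pre_digraph" where
  "bratteli_diagram A \<iota> \<Lambda> \<Delta> =
     \<lparr>verts = {(n, l). l \<in> \<Lambda> n},
      arcs = {(n, l, m, j). l \<in> \<Lambda> n \<and> m \<in> \<Lambda> (n + 1) \<and>
                j < multiplicity_in (A n) (\<Delta> n ` \<Lambda> n) (res \<iota> (n + 1) (\<Delta> (n + 1) m)) (\<Delta> n l)},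
      tail = (\<lambda>(n, l, m, j). (n, l)),
      head = (\<lambda>(n, l, m, j). (n + 1, m))\<rparr>"

definition bratteli_path_array ::
  "(nat \<Rightarrow> ('k, 'a) module) \<Rightarrow> (nat \<Rightarrow> 'a \<Rightarrow> 'a) \<Rightarrow> (nat \<Rightarrow> 'l set) \<Rightarrow>
   (nat \<Rightarrow> 'l \<Rightarrow> ('a, 'm) module) \<Rightarrow> 'l \<Rightarrow> nat \<Rightarrow> 'l \<Rightarrow> (nat \<times> 'l \<times> 'l \<times> nat) list set" where
  "bratteli_path_array A \<iota> \<Lambda> \<Delta> v0 n l =
     (if l \<in> \<Lambda> n
      then {p. pre_digraph.awalk (bratteli_diagram A \<iota> \<Lambda> \<Delta>) (0, v0) p (n, l)} else {})"

text \<open>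
  The root \<open>0\<close> is written \<open>v0\<close>. The functor \<open>F\<^sub>n\<close> is the pair of \<open>Fo n\<close> and \<open>Fm n\<close>.
  The period \<open>N\<close> may be \<open>0\<close>; congruence modulo \<open>0\<close> is equality.
\<close>

locale G0_tower =
  fixes K :: "('k, 'c) ring_scheme"
    and A :: "nat \<Rightarrow> ('k, 'a) module"
    and \<iota> :: "nat \<Rightarrow> 'a \<Rightarrow> 'a"
    and \<Lambda> :: "nat \<Rightarrow> 'l set"
    and \<Delta> :: "nat \<Rightarrow> 'l \<Rightarrow> ('a, 'm) module"
    and N :: nat
    and Fo :: "nat \<Rightarrow> ('a, 'm) module \<Rightarrow> ('a, 'm) module"
    and Fm :: "nat \<Rightarrow> ('a, 'm) module \<Rightarrow> ('a, 'm) module \<Rightarrow> ('m \<Rightarrow> 'm) \<Rightarrow> 'm \<Rightarrow> 'm"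
    and G :: "('l, 'e) pre_digraph"
    and v0 :: 'l
  assumes algebras: "assoc_algebra K (A n)"
    and N1: "algebra_embedding K (A n) (A (n + 1)) (\<iota> n)"
    and N2_module: "l \<in> \<Lambda> n \<Longrightarrow> left_module (A n) (\<Delta> n l)"
    and N2_not_iso:
      "\<lbrakk>l \<in> \<Lambda> n; m \<in> \<Lambda> n; l \<noteq> m\<rbrakk> \<Longrightarrow> \<not> module_iso (A n) (\<Delta> n l) (\<Delta> n m)"
    and N3_subset: "n \<ge> N \<Longrightarrow> \<Lambda> (n - N) \<subseteq> \<Lambda> n"
    and N3_cong: "\<Lambda> n \<inter> \<Lambda> n' \<noteq> {} \<Longrightarrow> [n = n'] (mod N)"
    and N4:
      "\<lbrakk>n \<ge> 1; l \<in> \<Lambda> n\<rbrakk>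
        \<Longrightarrow> good (A (n - 1)) (\<Delta> (n - 1) ` \<Lambda> (n - 1)) (res \<iota> n (\<Delta> n l))"
    and N5_labels: "\<Lambda> 0 = {v0}"
    and N5_simple: "simple_module (A 0) (\<Delta> 0 v0)"
    and N5_dim: "has_dimension K (underlying_space (A 0) (\<Delta> 0 v0)) 1"
    and N6: "n \<ge> N \<Longrightarrow> exact_functor (A n) (A (n - N)) (Fo n) (Fm n)"
    and N7_iso:
      "\<lbrakk>n \<ge> N; l \<in> \<Lambda> n; l \<in> \<Lambda> (n - N)\<rbrakk>
        \<Longrightarrow> module_iso (A (n - N)) (Fo n (\<Delta> n l)) (\<Delta> (n - N) l)"
    and N7_zero:
      "\<lbrakk>n \<ge> N; l \<in> \<Lambda> n; l \<notin> \<Lambda> (n - N)\<rbrakk> \<Longrightarrow> zero_module (Fo n (\<Delta> n l))"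
    and N8:
      "\<lbrakk>n \<ge> N + 1; l \<in> \<Lambda> n; \<not> zero_module (Fo n (\<Delta> n l))\<rbrakk>
        \<Longrightarrow> module_iso (A (n - N - 1))
              (Fo (n - 1) (res \<iota> n (\<Delta> n l))) (res \<iota> (n - N) (Fo n (\<Delta> n l)))"
    and N9_graph: "wf_digraph G" "verts G = (\<Union>n. \<Lambda> n)"
    and N9_arrows:
      "\<exists>arrow.
        (\<forall>n. \<forall>\<alpha>\<in>arcs G. tail G \<alpha> \<in> \<Lambda> n \<longrightarrow>
           tail (bratteli_diagram A \<iota> \<Lambda> \<Delta>) (arrow n \<alpha>) = (n, tail G \<alpha>) \<and>
           head (bratteli_diagram A \<iota> \<Lambda> \<Delta>) (arrow n \<alpha>) = (n + 1, head G \<alpha>)) \<and>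
        bij_betw (\<lambda>(n, \<alpha>). arrow n \<alpha>)
          {(n, \<alpha>). \<alpha> \<in> arcs G \<and> tail G \<alpha> \<in> \<Lambda> n} (arcs (bratteli_diagram A \<iota> \<Lambda> \<Delta>))"

end

theory Submission
  imports Defs
begin

text \<open>
  The arrows of the \<open>\<Delta>\<close>-Bratteli diagram correspond one-to-one to the pairs \<open>(n, \<alpha>)\<close> with
  \<open>\<alpha>\<close> an arc of \<open>G\<close> starting in \<open>\<Lambda>\<^sub>n\<close>. By this correspondence the diagram is \<open>G\<close> unrolled
  along the levels, and the last arrow of a path from \<open>\<Delta>\<^sub>0(0)\<close> to \<open>\<Delta>\<^sub>n\<^sub>+\<^sub>1(v)\<close> is \<open>\<alpha>\<^sub>n\<close> for
  exactly one arc \<open>\<alpha>\<close> of \<open>G\<close> that ends in \<open>v\<close>. Removing that arrow leaves a path to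
  \<open>\<Delta>\<^sub>n(tail \<alpha>)\<close>, and appending it is the inverse operation. So the maps \<open>p \<mapsto> p @ [\<alpha>\<^sub>n]\<close> are
  edge maps of a Pascal array (\<open>unrolled_paths_pascal\<close>).

  Equivalence with the path array then holds for every Pascal array
  (\<open>pascal_edge_maps_imp_equivalent\<close>). Unwinding the disjoint decomposition of \<open>Y(n;v)\<close> down to
  level \<open>0\<close>, each element arises from the unique element of \<open>Y(0;v\<^sub>0)\<close> by applying the edge
  maps along exactly one path of \<open>G\<close>.
\<close>

lemma (in wf_digraph) awalk_snoc_iff:
  "awalk u (p @ [a]) v \<longleftrightarrow> a \<in> arcs G \<and> head G a = v \<and> awalk u p (tail G a)"
  by (auto simp: awalk_append_iff awalk_Cons_iff awalk_Nil_iff)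


section \<open>Pascal arrays are equivalent to path arrays\<close>

text \<open>The enumeration supplies the level at which each edge map is applied.\<close>

definition apply_edge_maps :: "(nat \<Rightarrow> 'e \<Rightarrow> 'x \<Rightarrow> 'x) \<Rightarrow> 'x \<Rightarrow> 'e list \<Rightarrow> 'x" where
  "apply_edge_maps \<phi> x p = fold (\<lambda>(i, e). \<phi> i e) (List.enumerate 0 p) x"

lemma apply_edge_maps_Nil [simp]: "apply_edge_maps \<phi> x [] = x"
  by (simp add: apply_edge_maps_def)

lemma apply_edge_maps_snoc [simp]:
  "apply_edge_maps \<phi> x (p @ [e]) = \<phi> (length p) e (apply_edge_maps \<phi> x p)"
  by (simp add: apply_edge_maps_def enumerate_append_eq)

lemma (in rooted_digraph) path_array_0:
  "path_array G v0 0 v = (if v = v0 then {[]} else {})"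
  using root_in_verts by (auto simp: path_array_def awalk_Nil_iff)

lemma (in rooted_digraph) path_array_Suc:
  "path_array G v0 (Suc n) v =
     (\<Union>e\<in>{e \<in> arcs G. head G e = v}. (\<lambda>p. p @ [e]) ` path_array G v0 n (tail G e))"
proof (intro equalityI subsetI)
  fix q assume "q \<in> path_array G v0 (Suc n) v"
  then have q: "awalk v0 q v" "length q = Suc n"
    by (auto simp: path_array_def)
  then obtain p e where "q = p @ [e]" "length p = n"
    by (metis length_append_singleton length_Suc_conv_rev)
  with q show "q \<in> (\<Union>e\<in>{e \<in> arcs G. head G e = v}.
      (\<lambda>p. p @ [e]) ` path_array G v0 n (tail G e))"
    by (auto simp: path_array_def awalk_snoc_iff simp del: awalk_append_iff)
qed (auto simp: path_array_def awalk_snoc_iff simp del: awalk_append_iff)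

text \<open>
  By induction on the level: both arrays decompose over the arcs into \<open>v\<close>, and appending \<open>e\<close> to
  a path corresponds to applying the edge map of \<open>e\<close>, so the bijection at level \<open>n\<close> induces one on
  each block. The target blocks being disjoint is what makes the union of these bijections
  injective, that is, what makes the path leading to an element unique.
\<close>

lemma (in rooted_digraph) apply_edge_maps_bij:
  assumes pascal: "pascal_edge_maps G v0 Y \<phi>" and x: "Y 0 v0 = {x}" and "v \<in> verts G"
  shows "bij_betw (apply_edge_maps \<phi> x) (path_array G v0 n v) (Y n v)"
  using \<open>v \<in> verts G\<close>
proof (induction n arbitrary: v)
  case 0
  then show ?case
    using pascal x by (auto simp: path_array_0 pascal_edge_maps_def bij_betw_def)
next
  case (Suc n)
  let ?I = "{e \<in> arcs G. head G e = v}"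
  have Y: "Y (Suc n) v = (\<Union>e\<in>?I. \<phi> n e ` Y n (tail G e))"
    and disj: "disjoint_family_on (\<lambda>e. \<phi> n e ` Y n (tail G e)) ?I"
    using pascal Suc.prems by (auto simp: pascal_edge_maps_def)
  have "bij_betw (apply_edge_maps \<phi> x) ((\<lambda>p. p @ [e]) ` path_array G v0 n (tail G e))
          (\<phi> n e ` Y n (tail G e))" if e: "e \<in> ?I" for e
  proof -
    let ?P = "path_array G v0 n (tail G e)"
    have "inj_on (\<phi> n e) (Y n (tail G e))"
      using pascal e by (auto simp: pascal_edge_maps_def)
    then have "bij_betw (\<phi> n e \<circ> apply_edge_maps \<phi> x) ?P (\<phi> n e ` Y n (tail G e))"
      using Suc.IH[of "tail G e"] e by (auto intro: bij_betw_trans inj_on_imp_bij_betw)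
    then have "bij_betw (apply_edge_maps \<phi> x \<circ> (\<lambda>p. p @ [e])) ?P (\<phi> n e ` Y n (tail G e))"
      by (rule bij_betw_cong[THEN iffD1, rotated]) (auto simp: path_array_def)
    moreover have "bij_betw (\<lambda>p. p @ [e]) ?P ((\<lambda>p. p @ [e]) ` ?P)"
      by (auto simp: bij_betw_def inj_on_def)
    ultimately show ?thesis
      by (simp add: bij_betw_comp_iff)
  qed
  then show ?case
    unfolding Y path_array_Suc by (rule bij_betw_UNION_disjoint[OF disj])
qed

lemma (in rooted_digraph) pascal_edge_maps_imp_equivalent:
  assumes pascal: "pascal_edge_maps G v0 Y \<phi>"
  shows "equivalent_to_path_array G v0 Y"
proof -
  obtain x where x: "Y 0 v0 = {x}"
    using pascal by (auto simp: pascal_edge_maps_def)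
  show ?thesis
    unfolding equivalent_to_path_array_def
  proof (intro exI[of _ \<phi>] exI[of _ "\<lambda>_ _. apply_edge_maps \<phi> x"] conjI allI ballI)
    show "bij_betw (apply_edge_maps \<phi> x) (path_array G v0 n v) (Y n v)"
      if "v \<in> verts G" for n v
      using apply_edge_maps_bij[OF pascal x that] .
  qed (auto simp: pascal path_array_def)
qed


section \<open>Paths in a levelled unrolling of a graph\<close>

text \<open>
  The base level of \<open>B\<close> consists of the root alone and every arrow raises the level by one, so the
  only path back to the base level is the empty one. Injectivity of the arrow
  correspondence makes the blocks disjoint, and surjectivity makes them cover.
\<close>

lemma unrolled_paths_pascal:
  fixes G :: "('l, 'e) pre_digraph" and B :: "(nat \<times> 'l, 'b) pre_digraph"
  assumes B: "wf_digraph B"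
    and verts_B: "verts B = {(n, l). l \<in> \<Lambda> n}"
    and base: "\<Lambda> 0 = {v0}"
    and ends: "\<And>n e. e \<in> arcs G \<Longrightarrow> tail G e \<in> \<Lambda> n \<Longrightarrow>
        tail B (arrow n e) = (n, tail G e) \<and> head B (arrow n e) = (Suc n, head G e)"
    and bij: "bij_betw (\<lambda>(n, e). arrow n e) {(n, e). e \<in> arcs G \<and> tail G e \<in> \<Lambda> n} (arcs B)"
  shows "pascal_edge_maps G v0 (\<lambda>n l. {p. pre_digraph.awalk B (0, v0) p (n, l)})
           (\<lambda>n e p. p @ [arrow n e])"
proof -
  interpret B: wf_digraph B by (fact B)
  let ?Y = "\<lambda>n l. {p. B.awalk (0, v0) p (n, l)}"
  have end_in: "l \<in> \<Lambda> n" if "p \<in> ?Y n l" for p n l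
    using that B.awalk_last_in_verts verts_B by auto
  have arrow_in: "arrow n e \<in> arcs B" if "e \<in> arcs G" "tail G e \<in> \<Lambda> n" for n e
    using that bij_betw_apply[OF bij, of "(n, e)"] by auto
  have arrow_inj: "e = e'"
    if "arrow n e = arrow n e'" "e \<in> arcs G" "tail G e \<in> \<Lambda> n" "e' \<in> arcs G" "tail G e' \<in> \<Lambda> n"
    for n e e'
    using inj_onD[OF bij_betw_imp_inj_on[OF bij], of "(n, e)" "(n, e')"] that by auto
  have arrow_cases: "\<exists>e. e \<in> arcs G \<and> tail G e \<in> \<Lambda> m \<and> a = arrow m e \<and> n = Suc m \<and> head G e = l"
    if a: "a \<in> arcs B" and "head B a = (n, l)" "tail B a = (m, k)" for a n l m k
  proof -
    obtain i e where "e \<in> arcs G" "tail G e \<in> \<Lambda> i" "a = arrow i e"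
      using a unfolding bij_betw_imp_surj_on[OF bij, symmetric] by auto
    then show ?thesis using that ends[of e i] by auto
  qed
  have Y_0: "?Y 0 l = (if l = v0 then {[]} else {})" for l
  proof -
    have "p = [] \<and> l = v0" if "B.awalk (0, v0) p (0, l)" for p
    proof (cases p rule: rev_cases)
      case Nil
      with that show ?thesis by (simp add: B.awalk_Nil_iff)
    next
      case (snoc q a)
      then have "a \<in> arcs B" "head B a = (0, l)"
        using that by (simp_all add: B.awalk_snoc_iff del: B.awalk_append_iff)
      then show ?thesis
        using arrow_cases by (metis surj_pair Zero_not_Suc)
    qed
    then show ?thesis using base verts_B by (auto simp: B.awalk_Nil_iff)
  qed
  have append_in: "p @ [arrow n e] \<in> ?Y (Suc n) (head G e)"
    if "e \<in> arcs G" "p \<in> ?Y n (tail G e)" for n e p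
    using that end_in[OF that(2)] ends[of e n] arrow_in[of e n] by (simp add: B.awalk_snoc_iff del: B.awalk_append_iff)
  have Y_Suc: "?Y (Suc n) v =
      (\<Union>e\<in>{e \<in> arcs G. head G e = v}. (\<lambda>p. p @ [arrow n e]) ` ?Y n (tail G e))" for n v
  proof (intro equalityI subsetI)
    fix q assume q: "q \<in> ?Y (Suc n) v"
    then have "q \<noteq> []" by (auto simp: B.awalk_Nil_iff)
    then obtain p a where pa: "q = p @ [a]" by (metis rev_exhaust)
    then have a: "a \<in> arcs B" "head B a = (Suc n, v)" "B.awalk (0, v0) p (tail B a)"
      using q by (simp_all add: B.awalk_snoc_iff del: B.awalk_append_iff)
    then obtain e where e: "e \<in> arcs G" "tail G e \<in> \<Lambda> n" "a = arrow n e" "head G e = v"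
      using arrow_cases by (metis surj_pair Suc_inject)
    then have "p \<in> ?Y n (tail G e)" using a(3) ends by simp
    then show "q \<in> (\<Union>e\<in>{e \<in> arcs G. head G e = v}. (\<lambda>p. p @ [arrow n e]) ` ?Y n (tail G e))"
      using e pa by blast
  next
    fix q
    assume "q \<in> (\<Union>e\<in>{e \<in> arcs G. head G e = v}. (\<lambda>p. p @ [arrow n e]) ` ?Y n (tail G e))"
    then show "q \<in> ?Y (Suc n) v" using append_in by blast
  qed
  have disj: "disjoint_family_on (\<lambda>e. (\<lambda>p. p @ [arrow n e]) ` ?Y n (tail G e))
      {e \<in> arcs G. head G e = v}" for n v
  unfolding disjoint_family_on_def
  proof (intro ballI impI)
    fix e e'
    assume e: "e \<in> {e \<in> arcs G. head G e = v}" "e' \<in> {e \<in> arcs G. head G e = v}" "e \<noteq> e'"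
    have False if "p @ [arrow n e] = p' @ [arrow n e']"
        "p \<in> ?Y n (tail G e)" "p' \<in> ?Y n (tail G e')" for p p'
      using that(1) e arrow_inj[of n e e'] end_in[OF that(2)] end_in[OF that(3)] by simp
    then show "(\<lambda>p. p @ [arrow n e]) ` ?Y n (tail G e) \<inter>
        (\<lambda>p. p @ [arrow n e']) ` ?Y n (tail G e') = {}"
      by blast
  qed
  show ?thesis
    unfolding pascal_edge_maps_def
  proof (intro conjI allI ballI impI)
    show "\<exists>x. ?Y 0 v0 = {x}"
      using Y_0 by simp
  next
    show "?Y 0 v = {}" if "v \<noteq> v0" for v
      using Y_0 that by simp
  next
    show "inj_on (\<lambda>p. p @ [arrow n e]) (?Y n (tail G e))" for n e
      by (simp add: inj_on_def)
  next
    show "(\<lambda>p. p @ [arrow n e]) ` ?Y n (tail G e) \<subseteq> ?Y (Suc n) (head G e)"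
      if "e \<in> arcs G" for n e
      using append_in[OF that] by blast
  qed (rule Y_Suc disj)+
qed


section \<open>The Bratteli diagram of a tower\<close>

lemma wf_digraph_bratteli_diagram: "wf_digraph (bratteli_diagram A \<iota> \<Lambda> \<Delta>)"
  by unfold_locales (auto simp: bratteli_diagram_def)

lemma bratteli_path_array_eq:
  "bratteli_path_array A \<iota> \<Lambda> \<Delta> v0 =
     (\<lambda>n l. {p. pre_digraph.awalk (bratteli_diagram A \<iota> \<Lambda> \<Delta>) (0, v0) p (n, l)})"
proof -
  interpret B: wf_digraph "bratteli_diagram A \<iota> \<Lambda> \<Delta>"
    by (fact wf_digraph_bratteli_diagram)
  have "l \<in> \<Lambda> n" if "B.awalk (0, v0) p (n, l)" for p n l
    using B.awalk_last_in_verts[OF that] by (simp add: bratteli_diagram_def)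
  then show ?thesis
    by (auto simp: bratteli_path_array_def fun_eq_iff)
qed

lemma (in G0_tower) bratteli_path_array_pascal:
  "\<exists>\<phi>. pascal_edge_maps G v0 (bratteli_path_array A \<iota> \<Lambda> \<Delta> v0) \<phi>"
proof -
  let ?B = "bratteli_diagram A \<iota> \<Lambda> \<Delta>"
  obtain arrow where
    ends: "\<And>n e. e \<in> arcs G \<Longrightarrow> tail G e \<in> \<Lambda> n \<Longrightarrow>
      tail ?B (arrow n e) = (n, tail G e) \<and> head ?B (arrow n e) = (Suc n, head G e)"
    and bij: "bij_betw (\<lambda>(n, e). arrow n e) {(n, e). e \<in> arcs G \<and> tail G e \<in> \<Lambda> n} (arcs ?B)"
    using N9_arrows by auto
  have verts: "verts ?B = {(n, l). l \<in> \<Lambda> n}"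
    by (simp add: bratteli_diagram_def)
  show ?thesis
    unfolding bratteli_path_array_eq
    using unrolled_paths_pascal[OF wf_digraph_bratteli_diagram verts N5_labels ends bij] by blast
qed

theorem theorem4p6:
  fixes K :: "('k, 'c) ring_scheme"
    and A :: "nat \<Rightarrow> ('k, 'a) module"
    and \<iota> :: "nat \<Rightarrow> 'a \<Rightarrow> 'a"
    and \<Lambda> :: "nat \<Rightarrow> 'l set"
    and \<Delta> :: "nat \<Rightarrow> 'l \<Rightarrow> ('a, 'm) module"
    and N :: nat
    and Fo :: "nat \<Rightarrow> ('a, 'm) module \<Rightarrow> ('a, 'm) module"
    and Fm :: "nat \<Rightarrow> ('a, 'm) module \<Rightarrow> ('a, 'm) module \<Rightarrow> ('m \<Rightarrow> 'm) \<Rightarrow> 'm \<Rightarrow> 'm"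
    and G :: "('l, 'e) pre_digraph"
    and v0 :: 'l
  assumes "rooted_digraph G v0"
    and "G0_tower K A \<iota> \<Lambda> \<Delta> N Fo Fm G v0"
  shows "equivalent_to_path_array G v0 (bratteli_path_array A \<iota> \<Lambda> \<Delta> v0) \<and>
         pascal_array G v0 (bratteli_path_array A \<iota> \<Lambda> \<Delta> v0)"
proof -
  interpret rooted_digraph G v0 by (fact assms(1))
  interpret G0_tower K A \<iota> \<Lambda> \<Delta> N Fo Fm G v0 by (fact assms(2))
  obtain \<phi> where "pascal_edge_maps G v0 (bratteli_path_array A \<iota> \<Lambda> \<Delta> v0) \<phi>"
    using bratteli_path_array_pascal by blast
  then show ?thesis
    using pascal_edge_maps_imp_equivalent unfolding pascal_array_def by blast
qed

end
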